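(* Let $A$ be a C$^*$-algebra and let $\Delta : A\to A$ be a 2-local $^*$-derivation, that is, a map (not assumed linear nor continuous) such that for every $a,b\in A$ there exists a $^*$-derivation $D_{a,b}: A\to A$ (depending on $a$ and $b$) satisfying $\Delta(a) = D_{a,b}(a)$ and $\Delta(b) = D_{a,b}(b)$. Then $\Delta$ is a linear $^*$-derivation.
   Context: A derivation on $A$ is a linear map $D:A\to A$ with $D(xy)=D(x)y+xD(y)$ for all $x,y\in A$. A $^*$-derivation is a derivation $D$ with $D(x^* )=D(x)^*$ for all $x\in A$. *)

theory Defs
  imports "HOL-Analysis.Analysis"
begin

text \<open>
  Complex C*-algebras, not assumed unital (nor nonzero). The real normed structure is the
  restriction of scalars of the complex one; submultiplicativity of the norm and completeness
  come from the superclasses.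
\<close>

class cstar_algebra = real_normed_algebra + banach +
  fixes scaleC :: "complex \<Rightarrow> 'a \<Rightarrow> 'a"  (infixr \<open>*\<^sub>C\<close> 75)
    and star :: "'a \<Rightarrow> 'a"
  assumes scaleC_add_right: "c *\<^sub>C (x + y) = c *\<^sub>C x + c *\<^sub>C y"
    and scaleC_add_left: "(c + d) *\<^sub>C x = c *\<^sub>C x + d *\<^sub>C x"
    and scaleC_scaleC: "c *\<^sub>C (d *\<^sub>C x) = (c * d) *\<^sub>C x"
    and scaleR_scaleC: "r *\<^sub>R x = complex_of_real r *\<^sub>C x"
    and mult_scaleC_left: "(c *\<^sub>C x) * y = c *\<^sub>C (x * y)"
    and mult_scaleC_right: "x * (c *\<^sub>C y) = c *\<^sub>C (x * y)"
    and norm_scaleC: "norm (c *\<^sub>C x) = cmod c * norm x"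
    and star_add: "star (x + y) = star x + star y"
    and star_scaleC: "star (c *\<^sub>C x) = cnj c *\<^sub>C star x"
    and star_mult: "star (x * y) = star y * star x"
    and star_star: "star (star x) = x"
    and norm_star_mult_self: "norm (star x * x) = (norm x)\<^sup>2"

lemma vector_space_scaleC: "vector_space (scaleC :: complex \<Rightarrow> 'a::cstar_algebra \<Rightarrow> 'a)"
proof
  show "1 *\<^sub>C x = x" for x :: 'a
    using scaleR_scaleC[of 1 x] by simp
qed (simp_all add: scaleC_add_right scaleC_add_left scaleC_scaleC)

definition derivation :: "('a::cstar_algebra \<Rightarrow> 'a) \<Rightarrow> bool" where
  "derivation D \<longleftrightarrow>
     Vector_Spaces.linear scaleC scaleC D \<and> (\<forall>x y. D (x * y) = D x * y + x * D y)"

definition star_derivation :: "('a::cstar_algebra \<Rightarrow> 'a) \<Rightarrow> bool" where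
  "star_derivation D \<longleftrightarrow> derivation D \<and> (\<forall>x. D (star x) = star (D x))"

definition two_local_star_derivation :: "('a::cstar_algebra \<Rightarrow> 'a) \<Rightarrow> bool" where
  "two_local_star_derivation \<Delta> \<longleftrightarrow>
     (\<forall>a b. \<exists>D. star_derivation D \<and> \<Delta> a = D a \<and> \<Delta> b = D b)"

end

theory Submission imports Defs begin

text \<open>
  Additivity does not use the product rule. If \<open>h\<close>, \<open>k\<close> are self-adjoint then
  \<open>\<Delta> (h + i k) = \<Delta> h + i \<Delta> k\<close>, because \<open>\<Delta> (z + z\<^sup>*) = \<Delta> z + (\<Delta> z)\<^sup>*\<close> determines \<open>\<Delta>\<close> on the real and
  imaginary parts of \<open>z\<close>. Taking real parts in \<open>\<Delta> ((1 - i) (h + i k)) = (1 - i) \<Delta> (h + i k)\<close> then gives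
  \<open>\<Delta> (h + k) = \<Delta> h + \<Delta> k\<close>. Finally \<open>\<Delta> (x y\<^sup>*) - \<Delta> x y\<^sup>* - x \<Delta> (y\<^sup>*)\<close> is sesquilinear in \<open>(x, y)\<close>
  and vanishes on the diagonal, so it vanishes by polarization.
\<close>

interpretation scaleC: vector_space "scaleC :: complex \<Rightarrow> 'a::cstar_algebra \<Rightarrow> 'a"
  by (rule vector_space_scaleC)

lemmas scaleC_simps = scaleC.scale_right_distrib scaleC.scale_left_distrib
  scaleC.scale_right_diff_distrib scaleC.scale_left_diff_distrib

lemma scaleC_two: "2 *\<^sub>C x = x + x"
  for x :: "'a::cstar_algebra"
  using scaleC_add_left[of 1 1 x] by simp

lemma scaleC_half_double: "(1/2) *\<^sub>C x + (1/2) *\<^sub>C x = x"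
  for x :: "'a::cstar_algebra"
  using scaleC_add_left[of "1/2" "1/2" x] by simp

lemma star_diff: "star (x - y) = star x - star y"
  for x y :: "'a::cstar_algebra"
  using star_add[of "x - y" y] by simp

lemma star_minus: "star (- x) = - star x"
  for x :: "'a::cstar_algebra"
  using star_diff[of x "x + x"] by (simp add: star_add)

lemma self_adjoint_decomposition:
  fixes x :: "'a::cstar_algebra"
  obtains h k where "star h = h" "star k = k" "x = h + \<i> *\<^sub>C k"
proof
  show "star ((1/2) *\<^sub>C (x + star x)) = (1/2) *\<^sub>C (x + star x)"
    by (simp add: star_scaleC star_add star_star add.commute)
  \<comment> \<open>The second witness is \<open>(x - star x) / (2 i)\<close>.\<close>
  show "star ((\<i>/2) *\<^sub>C star x + (-\<i>/2) *\<^sub>C x) = (\<i>/2) *\<^sub>C star x + (-\<i>/2) *\<^sub>C x"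
    by (simp add: star_scaleC star_add star_diff star_star add.commute)
  show "x = (1/2) *\<^sub>C (x + star x) + \<i> *\<^sub>C ((\<i>/2) *\<^sub>C star x + (-\<i>/2) *\<^sub>C x)"
    using scaleC_half_double[of x] by (simp add: scaleC_simps algebra_simps)
qed

text \<open>Expanding the diagonal at \<open>u + v\<close> makes \<open>B\<close> antisymmetric.
  Replacing \<open>y\<close> by \<open>i y\<close> turns antisymmetry into symmetry, because the
  second argument is conjugate-linear; together they give \<open>2 B x y = 0\<close>.\<close>

lemma sesquilinear_eq_0_if_diagonal_eq_0:
  fixes B :: "'a::cstar_algebra \<Rightarrow> 'a \<Rightarrow> 'a"
  assumes add_left: "\<And>x y z. B (x + y) z = B x z + B y z"
    and add_right: "\<And>x y z. B x (y + z) = B x y + B x z"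
    and scale_left: "\<And>c x y. B (c *\<^sub>C x) y = c *\<^sub>C B x y"
    and scale_right: "\<And>c x y. B x (c *\<^sub>C y) = cnj c *\<^sub>C B x y"
    and diagonal: "\<And>x. B x x = 0"
  shows "B x y = 0"
proof -
  have skew: "B u v + B v u = 0" for u v
    using diagonal[of "u + v"] by (simp add: add_left add_right diagonal[of u] diagonal[of v] add.commute)
  have "\<i> *\<^sub>C B y x - \<i> *\<^sub>C B x y = 0"
    using skew[of x "\<i> *\<^sub>C y"] by (simp add: scale_left scale_right)
  then have "B y x = B x y"
    by simp
  then have "2 *\<^sub>C B x y = 0"
    using skew[of x y] by (simp add: scaleC_two)
  then show ?thesis
    by simp
qed

lemma star_derivationD:
  assumes "star_derivation D"
  shows "D (x + y) = D x + D y" "D (c *\<^sub>C x) = c *\<^sub>C D x"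
    "D (x * y) = D x * y + x * D y" "D (star x) = star (D x)"
  using assms
  by (auto simp: star_derivation_def derivation_def Vector_Spaces.linear_iff)

context
  fixes \<Delta> :: "'a::cstar_algebra \<Rightarrow> 'a"
  assumes two_local: "two_local_star_derivation \<Delta>"
begin

lemma two_localE:
  obtains D where "star_derivation D" "\<Delta> a = D a" "\<Delta> b = D b"
  using two_local unfolding two_local_star_derivation_def by blast

lemma two_local_scaleC: "\<Delta> (c *\<^sub>C x) = c *\<^sub>C \<Delta> x"
  by (rule two_localE[of x "c *\<^sub>C x"]) (simp add: star_derivationD)

lemma two_local_star: "\<Delta> (star x) = star (\<Delta> x)"
  by (rule two_localE[of x "star x"]) (simp add: star_derivationD)

lemma two_local_add_star: "\<Delta> (x + star x) = \<Delta> x + star (\<Delta> x)"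
  by (rule two_localE[of x "x + star x"]) (simp add: star_derivationD)

text \<open>The product rule would need a third value, at \<open>star x\<close>; it is replaced by
  \<open>star (D x)\<close>, so two points suffice.\<close>

lemma two_local_mult_star: "\<Delta> (x * star x) = \<Delta> x * star x + x * star (\<Delta> x)"
  by (rule two_localE[of x "x * star x"]) (simp add: star_derivationD)

lemma two_local_real_imaginary_parts:
  assumes "star h = h" "star k = k"
  shows "\<Delta> (h + \<i> *\<^sub>C k) = \<Delta> h + \<i> *\<^sub>C \<Delta> k"
proof -
  define z where "z = h + \<i> *\<^sub>C k"
  have "z + star z = 2 *\<^sub>C h"
    by (simp add: z_def star_add star_scaleC assms scaleC_two)
  then have h: "2 *\<^sub>C \<Delta> h = \<Delta> z + star (\<Delta> z)"
    using two_local_add_star[of z] by (simp add: two_local_scaleC)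
  \<comment> \<open>The imaginary part \<open>k\<close> of \<open>z\<close> is the real part of
    \<open>-i z\<close>, so the same argument applies after this rotation.\<close>
  have "(-\<i>) *\<^sub>C z + star ((-\<i>) *\<^sub>C z) = 2 *\<^sub>C k"
    by (simp add: z_def star_scaleC star_add star_diff assms scaleC_two scaleC_simps)
  then have k: "2 *\<^sub>C \<Delta> k = (-\<i>) *\<^sub>C \<Delta> z + \<i> *\<^sub>C star (\<Delta> z)"
    using two_local_add_star[of "(-\<i>) *\<^sub>C z"] two_local_scaleC[of "-\<i>" z]
    by (simp add: two_local_scaleC star_scaleC star_minus)
  have "2 *\<^sub>C (\<Delta> h + \<i> *\<^sub>C \<Delta> k) = 2 *\<^sub>C \<Delta> h + \<i> *\<^sub>C (2 *\<^sub>C \<Delta> k)"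
    by (simp add: scaleC_simps mult.commute)
  also have "\<dots> = 2 *\<^sub>C \<Delta> z"
    unfolding h k by (simp add: scaleC_simps scaleC_two)
  finally show ?thesis
    by (simp add: z_def)
qed

lemma two_local_add_self_adjoint:
  assumes "star h = h" "star k = k"
  shows "\<Delta> (h + k) = \<Delta> h + \<Delta> k"
proof -
  \<comment> \<open>The factor \<open>1 - i\<close> moves \<open>h + k\<close> into the real part,
    while homogeneity and the splitting of \<open>h + i k\<close> still compute
    \<open>\<Delta> z\<close>.\<close>
  define z where "z = (1 - \<i>) *\<^sub>C (h + \<i> *\<^sub>C k)"
  have z: "z = (h + k) + \<i> *\<^sub>C (k - h)"
    by (simp add: z_def scaleC_simps left_diff_distrib)
  have "z + star z = 2 *\<^sub>C (h + k)"
    by (simp add: z star_add star_diff star_scaleC assms scaleC_two)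
  then have "2 *\<^sub>C \<Delta> (h + k) = \<Delta> z + star (\<Delta> z)"
    using two_local_add_star[of z] by (simp add: two_local_scaleC)
  also have "\<Delta> z = (1 - \<i>) *\<^sub>C (\<Delta> h + \<i> *\<^sub>C \<Delta> k)"
    by (simp only: z_def two_local_scaleC two_local_real_imaginary_parts assms)
  also have "\<dots> = (\<Delta> h + \<Delta> k) + \<i> *\<^sub>C (\<Delta> k - \<Delta> h)"
    by (simp add: scaleC_simps left_diff_distrib)
  \<comment> \<open>\<Delta> commutes with \<open>star\<close>, so \<open>\<Delta> h\<close> and
    \<open>\<Delta> k\<close> are self-adjoint and the imaginary term cancels.\<close>
  also have "\<dots> + star \<dots> = 2 *\<^sub>C (\<Delta> h + \<Delta> k)"
    by (simp add: star_add star_diff star_scaleC assms scaleC_two flip: two_local_star)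
  finally show ?thesis
    by simp
qed

lemma two_local_add: "\<Delta> (x + y) = \<Delta> x + \<Delta> y"
proof -
  obtain h k where x: "star h = h" "star k = k" "x = h + \<i> *\<^sub>C k"
    by (rule self_adjoint_decomposition)
  obtain h' k' where y: "star h' = h'" "star k' = k'" "y = h' + \<i> *\<^sub>C k'"
    by (rule self_adjoint_decomposition)
  have "x + y = (h + h') + \<i> *\<^sub>C (k + k')"
    by (simp add: x y scaleC_simps)
  \<comment> \<open>Both \<open>h + h'\<close> and \<open>k + k'\<close> are self-adjoint;
    \<open>i (k + k')\<close> stays undistributed so that the splitting formula applies.\<close>
  moreover have "\<Delta> ((h + h') + \<i> *\<^sub>C (k + k')) = (\<Delta> h + \<Delta> h') + \<i> *\<^sub>C (\<Delta> k + \<Delta> k')"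
    using x y
    by (simp add: two_local_real_imaginary_parts two_local_add_self_adjoint star_add
        del: scaleC.scale_right_distrib)
  moreover have "\<dots> = \<Delta> x + \<Delta> y"
    using x y by (simp add: two_local_real_imaginary_parts scaleC_simps)
  ultimately show ?thesis
    by simp
qed

lemma two_local_mult: "\<Delta> (x * y) = \<Delta> x * y + x * \<Delta> y"
proof -
  \<comment> \<open>With \<open>star (\<Delta> v)\<close> in the last term, vanishing on the
    diagonal is exactly \<open>two_local_mult_star\<close>.\<close>
  define B where "B u v = \<Delta> (u * star v) - \<Delta> u * star v - u * star (\<Delta> v)" for u v
  have "B x (star y) = 0"
    by (rule sesquilinear_eq_0_if_diagonal_eq_0)
      (simp_all add: B_def two_local_add two_local_scaleC two_local_mult_star star_add star_scaleC
        mult_scaleC_left mult_scaleC_right scaleC_simps algebra_simps)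
  then show ?thesis
    by (simp add: B_def two_local_star star_star algebra_simps)
qed

end

theorem corollary2p9:
  fixes \<Delta> :: "'a::cstar_algebra \<Rightarrow> 'a"
  assumes "two_local_star_derivation \<Delta>"
  shows "star_derivation \<Delta>"
  using assms
  by (simp add: star_derivation_def derivation_def Vector_Spaces.linear_iff vector_space_scaleC
      two_local_add two_local_scaleC two_local_star two_local_mult)

end
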